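(* Let $\mathcal{G}=(G_n)_{n\ge1}$ be an $\mathrm{Inc}$-invariant chain of graphs with stability index $\mathrm{ind}(\mathcal{G})=r$. Assume that $V(G_r)=[r]$ and that $(1,i),(j,r)\in E(G_r)$ for some $i,j\in[r]$. Let $\gamma(G_n)$ and $\omega(G_n)$ denote the chromatic number and the clique number of $G_n$. Then $$\gamma(G_n)\le\omega(G_n)+1\quad\text{for all }n\ge r(4r-3).$$
   Context: $\mathbb{N}$ is the set of positive integers and $[n]=\{1,\dots,n\}$. Graphs are simple and finite, with vertex set contained in $\mathbb{N}$ (possibly empty); an edge $\{i,j\}$ with $i<j$ is written $(i,j)$. $G\subseteq H$ means $V(G)\subseteq V(H)$ and $E(G)\subseteq E(H)$. $\mathrm{Inc}$ is the monoid of strictly increasing maps $\pi:\mathbb{N}\to\mathbb{N}$, and $\mathrm{Inc}_{n,m}=\{\pi\in\mathrm{Inc}\mid\pi(n)\le m\}$ for $n\le m$. For $\Gamma\subseteq\mathrm{Inc}$ and a graph $G$, $\Gamma(G)$ is the graph with vertex set $\bigcup_{\pi\in\Gamma}\pi(V(G))$ and edge set $\{(\pi(i),\pi(j))\mid \pi\in\Gamma,(i,j)\in E(G)\}$. An $\mathrm{Inc}$-invariant chain of graphs is a sequence $(G_n)_{n\ge1}$ of graphs with $V(G_n)\subseteq[n]$ and $\mathrm{Inc}_{n,m}(G_n)\subseteq G_m$ for all $m\ge n\ge1$. Every such chain stabilizes: there is $r\in\mathbb{N}$ with $\mathrm{Inc}_{n,m}(G_n)=G_m$ for all $m\ge n\ge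 r$; the smallest such $r$ is the stability index $\mathrm{ind}(\mathcal{G})$. *)

theory Defs
  imports "HOL-Library.FuncSet" "HOL-Library.Ramsey"
begin

text \<open>The edge written \<open>(i, j)\<close> with \<open>i < j\<close> in the mathematical text is the
  two-element set \<open>{i, j}\<close> here.\<close>

record ngraph =
  verts :: "nat set"
  edges :: "nat set set"

definition simple_graph :: "ngraph \<Rightarrow> bool" where
  "simple_graph G \<longleftrightarrow> finite (verts G) \<and> verts G \<subseteq> {1..} \<and> edges G \<subseteq> nsets (verts G) 2"

definition subgraph :: "ngraph \<Rightarrow> ngraph \<Rightarrow> bool" where
  "subgraph G H \<longleftrightarrow> verts G \<subseteq> verts H \<and> edges G \<subseteq> edges H"

text \<open>Strictly increasing self-maps of the positive integers. Their value at \<open>0\<close> is left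
  unconstrained; it plays no role, since \<open>0\<close> is never a vertex.\<close>

definition Inc :: "(nat \<Rightarrow> nat) set" where
  "Inc = {\<pi> \<in> {1..} \<rightarrow> {1..}. strict_mono_on {1..} \<pi>}"

definition Inc_upto :: "nat \<Rightarrow> nat \<Rightarrow> (nat \<Rightarrow> nat) set" where
  "Inc_upto n m = {\<pi> \<in> Inc. \<pi> n \<le> m}"

definition graph_image :: "(nat \<Rightarrow> nat) set \<Rightarrow> ngraph \<Rightarrow> ngraph" where
  "graph_image \<Gamma> G =
     \<lparr> verts = (\<Union>\<pi>\<in>\<Gamma>. \<pi> ` verts G),
       edges = {{\<pi> i, \<pi> j} | \<pi> i j. \<pi> \<in> \<Gamma> \<and> i < j \<and> {i, j} \<in> edges G} \<rparr>"

text \<open>Chains are indexed by the positive integers; the entry \<open>G 0\<close> is ignored throughout.\<close>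

definition Inc_invariant_chain :: "(nat \<Rightarrow> ngraph) \<Rightarrow> bool" where
  "Inc_invariant_chain G \<longleftrightarrow>
     (\<forall>n\<ge>1. simple_graph (G n) \<and> verts (G n) \<subseteq> {1..n}) \<and>
     (\<forall>n\<ge>1. \<forall>m\<ge>n. subgraph (graph_image (Inc_upto n m) (G n)) (G m))"

definition stability_index :: "(nat \<Rightarrow> ngraph) \<Rightarrow> nat" where
  "stability_index G =
     (LEAST r. 1 \<le> r \<and> (\<forall>n\<ge>r. \<forall>m\<ge>n. graph_image (Inc_upto n m) (G n) = G m))"

definition proper_colouring :: "ngraph \<Rightarrow> nat \<Rightarrow> (nat \<Rightarrow> nat) \<Rightarrow> bool" where
  "proper_colouring G k c \<longleftrightarrow>
     c \<in> verts G \<rightarrow> {..<k} \<and> (\<forall>u v. {u, v} \<in> edges G \<longrightarrow> c u \<noteq> c v)"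

definition chromatic_number :: "ngraph \<Rightarrow> nat" where
  "chromatic_number G = (LEAST k. \<exists>c. proper_colouring G k c)"

definition clique_number :: "ngraph \<Rightarrow> nat" where
  "clique_number G = Max {card K | K. K \<subseteq> verts G \<and> clique K (edges G)}"

end

theory Submission
  imports Defs
begin

text \<open>
  Think of the vertices \<open>1, \<dots>, n\<close> as placed on a circle. An edge \<open>i < j\<close> of \<open>G\<^sub>r\<close> is determined by
  the gaps \<open>i\<close>, \<open>j - i\<close>, \<open>r - j\<close> before, between and after its endpoints, and the maps in \<open>Inc_upto r n\<close>
  are able to enlarge the three gaps independently (\<open>edge_graph_image_iff\<close>). So \<open>a < b\<close> is an edge of
  \<open>G\<^sub>n\<close> iff its three gaps dominate those of an edge of \<open>G\<^sub>r\<close>. Let \<open>\<delta>\<close> be the smallest middle gap of an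
  edge of \<open>G\<^sub>r\<close>. Vertices far from both ends of \<open>{1..n}\<close> are adjacent iff their distance is at least
  \<open>\<delta>\<close>, so a block \<open>Q\<close> of \<open>\<delta>\<close> consecutive vertices there is independent.

  Deleting \<open>Q\<close> cuts the circle open. Read the remaining vertices along the circle, starting right
  after \<open>Q\<close>, passing from \<open>n\<close> to \<open>1\<close>, and ending right before \<open>Q\<close>. In this order adjacency is transitive.
  Indeed, if \<open>x\<close>, \<open>y\<close>, \<open>z\<close> come in this order and \<open>x y\<close> and \<open>y z\<close> are edges, then each gap of the pair
  \<open>x z\<close> that could be too small is inherited from one of these two edges, the same one for all such
  gaps, unless \<open>x\<close> and \<open>z\<close> are close to \<open>Q\<close> on opposite sides, and then \<open>Q\<close> itself keeps them at
  distance more than \<open>\<delta>\<close>. Thus \<open>G\<^sub>n - Q\<close> is a comparability graph, and colouring each vertex by its height uses only as many colours as a largest clique has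
  vertices (\<open>height_colouring\<close>, one half of Mirsky's theorem). One extra colour serves \<open>Q\<close>. The
  argument is \<open>chromatic_number_stretched_graph\<close>.

  It rests on \<open>G\<^sub>n\<close> being generated by \<open>G\<^sub>r\<close>, which holds once some stabilization point is known to
  exist, since \<open>stability_index\<close> is a \<open>LEAST\<close>. That existence is Dickson's lemma applied to the
  gap triples of all edges and the gap pairs of all vertices in the chain
  (\<open>stability_index_stable\<close>).
\<close>

section \<open>Stretching an edge\<close>

text \<open>Each of the gaps \<open>i\<close>, \<open>j - i\<close>, \<open>n - j\<close> cut out of \<open>{1..n}\<close> by \<open>i < j\<close> is at most the corresponding gap
  that \<open>a < b\<close> cuts out of \<open>{1..m}\<close>. The inequalities are written additively because subtraction on
  \<open>nat\<close> truncates.\<close>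
definition stretches :: "nat \<Rightarrow> nat \<Rightarrow> nat \<Rightarrow> nat \<Rightarrow> nat \<Rightarrow> nat \<Rightarrow> bool" where
  "stretches n i j m a b \<longleftrightarrow> i \<le> a \<and> a + j \<le> b + i \<and> n + b \<le> m + j"

lemma Inc_gap:
  assumes "\<pi> \<in> Inc" "1 \<le> i" "i \<le> j"
  shows "\<pi> i + j \<le> \<pi> j + i"
  using assms(3)
proof (induction j rule: dec_induct)
  case (step j)
  have "\<pi> j < \<pi> (Suc j)"
    using assms(1,2) step.hyps by (auto simp: Inc_def intro: strict_mono_onD)
  then show ?case using step.IH by simp
qed simp

lemma Inc_ge:
  assumes "\<pi> \<in> Inc" "1 \<le> i"
  shows "i \<le> \<pi> i"
proof -
  have "1 \<le> \<pi> 1" using assms(1) by (auto simp: Inc_def)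
  then show ?thesis using Inc_gap[OF assms(1), of 1 i] assms(2) by simp
qed

lemma stretches_Inc:
  assumes "\<pi> \<in> Inc_upto n m" "1 \<le> i" "i < j" "j \<le> n"
  shows "stretches n i j m (\<pi> i) (\<pi> j)"
proof -
  have "\<pi> \<in> Inc" "\<pi> n \<le> m" using assms(1) by (auto simp: Inc_upto_def)
  moreover have "\<pi> j + n \<le> \<pi> n + j" using Inc_gap[of \<pi> j n] calculation assms by simp
  ultimately show ?thesis
    using Inc_ge[of \<pi> i] Inc_gap[of \<pi> i j] assms by (simp add: stretches_def)
qed

lemma Inc_of_stretches:
  assumes "stretches n i j m a b" "1 \<le> i" "i < j" "j \<le> n"
  obtains \<pi> where "\<pi> \<in> Inc_upto n m" "\<pi> i = a" "\<pi> j = b"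
proof
  let ?\<pi> = "\<lambda>x. x + (if x < i then 0 else if x < j then a - i else b - j)"
  show "?\<pi> \<in> Inc_upto n m"
    using assms by (auto simp: stretches_def Inc_upto_def Inc_def strict_mono_on_def)
  show "?\<pi> i = a" "?\<pi> j = b" using assms by (auto simp: stretches_def)
qed

lemma Inc_of_vertex_shift:
  assumes "v \<le> w" "n + w \<le> m + v" "1 \<le> v" "v \<le> n"
  obtains \<pi> where "\<pi> \<in> Inc_upto n m" "\<pi> v = w"
proof
  let ?\<pi> = "\<lambda>x. x + (if x < v then 0 else w - v)"
  show "?\<pi> \<in> Inc_upto n m"
    using assms by (auto simp: Inc_upto_def Inc_def strict_mono_on_def)
  show "?\<pi> v = w" using assms by auto
qed

lemma edge_endpoints:
  assumes "e \<in> edges H" "edges H \<subseteq> nsets {1..n} 2"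
  obtains a b where "e = {a, b}" "1 \<le> a" "a < b" "b \<le> (n::nat)"
proof -
  have "e \<in> nsets {1..n} 2" using assms by auto
  then obtain x y where "e = {x, y}" "x \<noteq> y" "x \<in> {1..n}" "y \<in> {1..n}"
    by (auto simp: nsets_def card_2_iff)
  then show ?thesis
    using that[of x y] that[of y x] by (cases "x < y") (auto simp: insert_commute)
qed

text \<open>A strictly increasing map never shrinks a gap, and conversely any prescribed enlargement of
  the three gaps of an edge is realized by a map that shifts the points from \<open>i\<close> on by one constant
  and the points from \<open>j\<close> on by a larger one.\<close>
lemma edge_graph_image_iff:
  assumes "edges H \<subseteq> nsets {1..n} 2" "a < b"
  shows "{a, b} \<in> edges (graph_image (Inc_upto n m) H) \<longleftrightarrow>
    (\<exists>i j. {i, j} \<in> edges H \<and> 1 \<le> i \<and> i < j \<and> j \<le> n \<and> stretches n i j m a b)"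
proof
  assume "{a, b} \<in> edges (graph_image (Inc_upto n m) H)"
  then obtain \<pi> i j where *: "{a, b} = {\<pi> i, \<pi> j}" "\<pi> \<in> Inc_upto n m" "i < j" "{i, j} \<in> edges H"
    by (auto simp: graph_image_def)
  have ij: "1 \<le> i" "j \<le> n"
    using edge_endpoints[OF *(4) assms(1)] *(3) by (metis doubleton_eq_iff order_less_asym)+
  have st: "stretches n i j m (\<pi> i) (\<pi> j)" using stretches_Inc * ij by blast
  then have "\<pi> i < \<pi> j" using *(3) by (simp add: stretches_def)
  then have "a = \<pi> i" "b = \<pi> j" using *(1) assms(2) by (auto simp: doubleton_eq_iff)
  then show "\<exists>i j. {i, j} \<in> edges H \<and> 1 \<le> i \<and> i < j \<and> j \<le> n \<and> stretches n i j m a b"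
    using * ij st by blast
next
  assume "\<exists>i j. {i, j} \<in> edges H \<and> 1 \<le> i \<and> i < j \<and> j \<le> n \<and> stretches n i j m a b"
  then obtain i j where *: "{i, j} \<in> edges H" "1 \<le> i" "i < j" "j \<le> n" "stretches n i j m a b"
    by blast
  then obtain \<pi> where "\<pi> \<in> Inc_upto n m" "\<pi> i = a" "\<pi> j = b" using Inc_of_stretches by blast
  then show "{a, b} \<in> edges (graph_image (Inc_upto n m) H)"
    unfolding graph_image_def using *(1,3) by auto
qed

section \<open>Stabilization\<close>

text \<open>The finite basis form of the well-quasi-order property. Closure under products with \<open>\<nat>\<close>
  then yields Dickson's lemma in every dimension.\<close>
definition has_finite_bases :: "('a \<Rightarrow> 'a \<Rightarrow> bool) \<Rightarrow> bool" where
  "has_finite_bases le \<longleftrightarrow> (\<forall>A. \<exists>B. finite B \<and> B \<subseteq> A \<and> (\<forall>a\<in>A. \<exists>b\<in>B. le b a))"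

lemma has_finite_basesD:
  assumes "has_finite_bases le"
  obtains B where "finite B" "B \<subseteq> A" "\<And>a. a \<in> A \<Longrightarrow> \<exists>b\<in>B. le b a"
  using assms unfolding has_finite_bases_def by metis

lemma has_finite_bases_nat: "has_finite_bases ((\<le>) :: nat \<Rightarrow> nat \<Rightarrow> bool)"
  unfolding has_finite_bases_def
proof
  fix A :: "nat set"
  show "\<exists>B. finite B \<and> B \<subseteq> A \<and> (\<forall>a\<in>A. \<exists>b\<in>B. b \<le> a)"
  proof (cases "A = {}")
    case False
    then show ?thesis
      by (intro exI[of _ "{LEAST a. a \<in> A}"]) (auto intro: LeastI Least_le)
  qed auto
qed

text \<open>Lift a finite basis \<open>C\<close> of the projection of \<open>A\<close> to points of \<open>A\<close>, with first coordinates at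
  most \<open>N\<close>. These lifts lie below every point of \<open>A\<close> whose first coordinate exceeds \<open>N\<close>, and for each of
  the finitely many other first coordinates a finite basis of the slice takes care of the rest.\<close>
lemma has_finite_bases_prod_nat:
  assumes "has_finite_bases le"
  shows "has_finite_bases (\<lambda>(x :: nat, p) (y, q). x \<le> y \<and> le p q)"
  unfolding has_finite_bases_def
proof
  fix A :: "(nat \<times> 'a) set"
  obtain C where C: "finite C" "C \<subseteq> snd ` A" "\<And>a. a \<in> snd ` A \<Longrightarrow> \<exists>b\<in>C. le b a"
    using has_finite_basesD[OF assms] by blast
  then have "\<forall>p\<in>C. \<exists>x. (x, p) \<in> A" by force
  then obtain f where f: "\<And>p. p \<in> C \<Longrightarrow> (f p, p) \<in> A" by metis
  obtain N where N: "\<And>p. p \<in> C \<Longrightarrow> f p \<le> N"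
    using C(1) by (meson finite_imageI finite_nat_set_iff_bounded_le imageI)
  have "\<exists>B. finite B \<and> B \<subseteq> {p. (x, p) \<in> A} \<and> (\<forall>a\<in>{p. (x, p) \<in> A}. \<exists>b\<in>B. le b a)" for x
    using assms unfolding has_finite_bases_def by blast
  then obtain S where S: "\<And>x. finite (S x)" "\<And>x. S x \<subseteq> {p. (x, p) \<in> A}"
    "\<And>x p. (x, p) \<in> A \<Longrightarrow> \<exists>b\<in>S x. le b p"
    by (metis mem_Collect_eq)
  define B where "B = (\<lambda>p. (f p, p)) ` C \<union> (\<Union>x\<in>{..N}. Pair x ` S x)"
  have "finite B" using C(1) S(1) by (simp add: B_def)
  moreover have "B \<subseteq> A" using f S(2) by (auto simp: B_def)
  moreover have "\<exists>b\<in>B. (case b of (x, p) \<Rightarrow> \<lambda>(y, q). x \<le> y \<and> le p q) a" if "a \<in> A" for a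
  proof -
    obtain y q where a: "a = (y, q)" by fastforce
    show ?thesis
    proof (cases "y \<le> N")
      case True
      obtain b where "b \<in> S y" "le b q" using S(3) \<open>a \<in> A\<close> a by blast
      then show ?thesis using True a by (intro bexI[of _ "(y, b)"]) (auto simp: B_def)
    next
      case False
      have "q \<in> snd ` A" using \<open>a \<in> A\<close> a by force
      then obtain b where "b \<in> C" "le b q" using C(3) by blast
      then show ?thesis using False a N[of b] by (intro bexI[of _ "(f b, b)"]) (auto simp: B_def)
    qed
  qed
  ultimately show "\<exists>B. finite B \<and> B \<subseteq> A \<and>
      (\<forall>a\<in>A. \<exists>b\<in>B. (case b of (x, p) \<Rightarrow> \<lambda>(y, q). x \<le> y \<and> le p q) a)"
    by (intro exI[of _ B] conjI ballI)
qed

lemma Inc_invariant_chainD: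
  assumes "Inc_invariant_chain G" "1 \<le> n"
  shows "finite (verts (G n))" "verts (G n) \<subseteq> {1..n}" "edges (G n) \<subseteq> nsets {1..n} 2"
    "edges (G n) \<subseteq> nsets (verts (G n)) 2"
    "n \<le> m \<Longrightarrow> subgraph (graph_image (Inc_upto n m) (G n)) (G m)"
  using assms nsets_mono[of "verts (G n)" "{1..n}" 2]
  unfolding Inc_invariant_chain_def simple_graph_def by blast+

lemma Inc_invariant_chain_edge:
  assumes "Inc_invariant_chain G" "{i, j} \<in> edges (G n)" "1 \<le> i" "i < j" "j \<le> n"
    "stretches n i j m a b"
  shows "{a, b} \<in> edges (G m)"
proof -
  have "n \<le> m" "a < b" "1 \<le> n" using assms(3-6) by (auto simp: stretches_def)
  then have "{a, b} \<in> edges (graph_image (Inc_upto n m) (G n))"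
    using edge_graph_image_iff Inc_invariant_chainD(3)[OF assms(1)] assms(2-6) by blast
  then show ?thesis
    using Inc_invariant_chainD(5)[OF assms(1) \<open>1 \<le> n\<close> \<open>n \<le> m\<close>] by (auto simp: subgraph_def)
qed

lemma Inc_invariant_chain_vertex:
  assumes "Inc_invariant_chain G" "v \<in> verts (G n)" "1 \<le> v" "v \<le> n" "v \<le> w" "n + w \<le> m + v"
  shows "w \<in> verts (G m)"
proof -
  obtain \<pi> where "\<pi> \<in> Inc_upto n m" "\<pi> v = w" using Inc_of_vertex_shift assms(3-6) by blast
  then have "w \<in> verts (graph_image (Inc_upto n m) (G n))"
    using assms(2) by (auto simp: graph_image_def)
  moreover have "1 \<le> n" "n \<le> m" using assms(3-6) by auto
  ultimately show ?thesis
    using Inc_invariant_chainD(5)[OF assms(1)] by (auto simp: subgraph_def)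
qed

text \<open>By Dickson's lemma the gap triples of all edges of all \<open>G\<^sub>k\<close> lie above finitely many of them, which
  come from graphs \<open>G\<^sub>k\<close> with \<open>k \<le> N\<close>. An edge of \<open>G\<^sub>m\<close> thus arises by stretching an edge of some such
  \<open>G\<^sub>k\<close>, and for \<open>k \<le> n \<le> m\<close> the stretching can be interrupted in \<open>G\<^sub>n\<close>.\<close>
lemma eventually_all_edges_from_below:
  assumes G: "Inc_invariant_chain G"
  shows "\<exists>N. \<forall>n\<ge>N. \<forall>m\<ge>n. 1 \<le> n \<longrightarrow>
    edges (G m) \<subseteq> edges (graph_image (Inc_upto n m) (G n))"
proof -
  define A where "A = {(i, d, u). 1 \<le> i \<and> 1 \<le> d \<and> {i, i + d} \<in> edges (G (i + d + u))}"
  obtain B where B: "finite B" "B \<subseteq> A"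
    "\<And>p. p \<in> A \<Longrightarrow> \<exists>q\<in>B. (\<lambda>(x, p) (y, q). x \<le> y \<and> (\<lambda>(x, p) (y, q). x \<le> y \<and> p \<le> q) p q) q p"
    using has_finite_basesD[OF has_finite_bases_prod_nat[OF has_finite_bases_prod_nat[OF
          has_finite_bases_nat]]] by blast
  obtain N where N: "\<And>i d u. (i, d, u) \<in> B \<Longrightarrow> i + d + u \<le> N"
  proof -
    obtain N where "\<forall>x\<in>(\<lambda>(i, d, u). i + d + u) ` B. x \<le> N"
      using B(1) by (meson finite_imageI finite_nat_set_iff_bounded_le)
    then show ?thesis using that[of N] by fastforce
  qed
  have "e \<in> edges (graph_image (Inc_upto n m) (G n))"
    if nm: "N \<le> n" "n \<le> m" "1 \<le> n" and e: "e \<in> edges (G m)" for n m e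
  proof -
    obtain a b where ab: "e = {a, b}" "1 \<le> a" "a < b" "b \<le> m"
      using edge_endpoints[OF e] Inc_invariant_chainD(3)[OF G, of m] nm by auto
    then have "(a, b - a, m - b) \<in> A" using e by (auto simp: A_def)
    then obtain i d u where B': "(i, d, u) \<in> B" "i \<le> a" "d \<le> b - a" "u \<le> m - b"
      using B(3) by fastforce
    have A: "1 \<le> i" "1 \<le> d" "{i, i + d} \<in> edges (G (i + d + u))"
      using B(2) B'(1) by (auto simp: A_def)
    have sum: "i + d + u \<le> n" using N B'(1) nm(1) by force
    \<comment> \<open>The intermediate gaps, of total \<open>n\<close>: enlarge the first gap as far as the target and \<open>n\<close>
      permit, then the second, and let the third absorb what is left.\<close>
    define i' where "i' = min a (n - d - u)"
    define d' where "d' = min (b - a) (n - i' - u)"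
    have 1: "i \<le> i'" "d \<le> d'" "i' + d' + u \<le> n" "i' \<le> a" "d' \<le> b - a" "n + b \<le> m + (i' + d')"
      using B'(2-4) sum nm(2) ab(3,4) by (auto simp: i'_def d'_def min_def)
    have "{i', i' + d'} \<in> edges (G n)"
      using Inc_invariant_chain_edge[OF G A(3)] A 1 by (simp add: stretches_def)
    then show ?thesis
      unfolding ab(1) edge_graph_image_iff[OF Inc_invariant_chainD(3)[OF G nm(3)] ab(3)]
      using A 1 ab by (intro exI[of _ i'] exI[of _ "i' + d'"]) (auto simp: stretches_def)
  qed
  then show ?thesis by blast
qed

text \<open>The same argument with the two gaps \<open>v\<close> and \<open>n - v\<close> of a single vertex.\<close>
lemma eventually_all_vertices_from_below:
  assumes G: "Inc_invariant_chain G"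
  shows "\<exists>N. \<forall>n\<ge>N. \<forall>m\<ge>n. 1 \<le> n \<longrightarrow>
    verts (G m) \<subseteq> verts (graph_image (Inc_upto n m) (G n))"
proof -
  define A where "A = {(v, u). 1 \<le> v \<and> v \<in> verts (G (v + u))}"
  obtain B where B: "finite B" "B \<subseteq> A"
    "\<And>p. p \<in> A \<Longrightarrow> \<exists>q\<in>B. (\<lambda>(x, p) (y, q). x \<le> y \<and> p \<le> q) q p"
    using has_finite_basesD[OF has_finite_bases_prod_nat[OF has_finite_bases_nat]] by blast
  obtain N where N: "\<And>v u. (v, u) \<in> B \<Longrightarrow> v + u \<le> N"
  proof -
    obtain N where "\<forall>x\<in>(\<lambda>(v, u). v + u) ` B. x \<le> N"
      using B(1) by (meson finite_imageI finite_nat_set_iff_bounded_le)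
    then show ?thesis using that[of N] by fastforce
  qed
  have "w \<in> verts (graph_image (Inc_upto n m) (G n))"
    if nm: "N \<le> n" "n \<le> m" "1 \<le> n" and w: "w \<in> verts (G m)" for n m w
  proof -
    have wm: "1 \<le> w" "w \<le> m" using w Inc_invariant_chainD(2)[OF G, of m] nm by auto
    then have "(w, m - w) \<in> A" using w by (auto simp: A_def)
    then obtain v u where B': "(v, u) \<in> B" "v \<le> w" "u \<le> m - w" using B(3) by fastforce
    have A: "1 \<le> v" "v \<in> verts (G (v + u))" using B(2) B'(1) by (auto simp: A_def)
    have sum: "v + u \<le> n" using N B'(1) nm(1) by force
    define v' where "v' = min w (n - u)"
    have 1: "v \<le> v'" "v' + u \<le> n" "v' \<le> w" "n + w \<le> m + v'"
      using B'(2,3) sum nm(2) wm by (auto simp: v'_def min_def)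
    have "v' \<in> verts (G n)"
      using Inc_invariant_chain_vertex[OF G A(2)] A 1 by simp
    moreover obtain \<pi> where "\<pi> \<in> Inc_upto n m" "\<pi> v' = w"
      using Inc_of_vertex_shift[of v' w n m] A 1 by auto
    ultimately show ?thesis by (auto simp: graph_image_def)
  qed
  then show ?thesis by blast
qed

lemma stability_index_stable:
  assumes G: "Inc_invariant_chain G"
  shows "1 \<le> stability_index G"
    and "stability_index G \<le> n \<Longrightarrow>
      graph_image (Inc_upto (stability_index G) n) (G (stability_index G)) = G n"
proof -
  let ?P = "\<lambda>r. 1 \<le> r \<and> (\<forall>n\<ge>r. \<forall>m\<ge>n. graph_image (Inc_upto n m) (G n) = G m)"
  obtain N1 where N1: "\<forall>n\<ge>N1. \<forall>m\<ge>n. 1 \<le> n \<longrightarrow>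
      edges (G m) \<subseteq> edges (graph_image (Inc_upto n m) (G n))"
    using eventually_all_edges_from_below[OF G] by blast
  obtain N2 where N2: "\<forall>n\<ge>N2. \<forall>m\<ge>n. 1 \<le> n \<longrightarrow>
      verts (G m) \<subseteq> verts (graph_image (Inc_upto n m) (G n))"
    using eventually_all_vertices_from_below[OF G] by blast
  have "?P (Suc (max N1 N2))"
  proof (intro conjI allI impI)
    fix n m assume n: "Suc (max N1 N2) \<le> n" and m: "n \<le> m"
    have "subgraph (graph_image (Inc_upto n m) (G n)) (G m)"
      using Inc_invariant_chainD(5)[OF G _ m] n by simp
    then show "graph_image (Inc_upto n m) (G n) = G m"
      using N1 N2 n m by (intro ngraph.equality) (auto simp: subgraph_def subset_antisym)
  qed simp
  then have stable: "?P (stability_index G)" unfolding stability_index_def by (rule LeastI)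
  show "1 \<le> stability_index G"
    and "stability_index G \<le> n \<Longrightarrow>
      graph_image (Inc_upto (stability_index G) n) (G (stability_index G)) = G n"
    by (fact conjunct1[OF stable], rule conjunct2[OF stable, rule_format, OF order_refl])
qed

section \<open>Colouring graphs that are transitive outside an independent set\<close>

text \<open>The colour of \<open>x\<close> is its height, the largest size of a chain strictly below \<open>x\<close>. Appending
  \<open>x\<close> to such a chain gives a chain below every \<open>y\<close> above \<open>x\<close>, so heights increase along \<open>R\<close> and
  stay below the largest size of a chain.\<close>
lemma height_colouring:
  assumes "finite S"
    and irrefl: "\<And>x. x \<in> S \<Longrightarrow> \<not> R x x"
    and trans: "\<And>x y z. \<lbrakk>x \<in> S; y \<in> S; z \<in> S; R x y; R y z\<rbrakk> \<Longrightarrow> R x z"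
    and bound: "\<And>K. \<lbrakk>K \<subseteq> S; \<forall>x\<in>K. \<forall>y\<in>K. x \<noteq> y \<longrightarrow> R x y \<or> R y x\<rbrakk> \<Longrightarrow> card K \<le> k"
  obtains c :: "'a \<Rightarrow> nat"
  where "\<And>x. x \<in> S \<Longrightarrow> c x < k" "\<And>x y. \<lbrakk>x \<in> S; y \<in> S; R x y\<rbrakk> \<Longrightarrow> c x < c y"
proof -
  define D where "D x = {K. K \<subseteq> {y \<in> S. R y x} \<and> (\<forall>x\<in>K. \<forall>y\<in>K. x \<noteq> y \<longrightarrow> R x y \<or> R y x)}" for x
  define c where "c x = Max (card ` D x)" for x
  have "D x \<subseteq> Pow S" for x by (auto simp: D_def)
  then have fin: "finite (card ` D x)" for x
    using \<open>finite S\<close> by (meson finite_Pow_iff finite_imageI finite_subset)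
  have "card ` D x \<noteq> {}" for x by (auto simp: D_def)
  then have "\<exists>K\<in>D x. card K = c x" for x
    using Max_in[OF fin, of x] by (auto simp: c_def)
  then obtain M where M: "\<And>x. M x \<in> D x" "\<And>x. card (M x) = c x" by metis
  have card_insert: "card (insert x (M x)) = Suc (c x)" if "x \<in> S" for x
  proof -
    have "finite (M x)" "x \<notin> M x"
      using M(1)[of x] \<open>finite S\<close> irrefl[OF that] finite_subset[of "M x" S]
      by (auto simp: D_def)
    then show ?thesis using M(2) by simp
  qed
  show ?thesis
  proof
    fix x assume x: "x \<in> S"
    have "card (insert x (M x)) \<le> k" using M(1)[of x] x by (intro bound) (auto simp: D_def)
    then show "c x < k" using card_insert[OF x] by simp
  next
    fix x y assume xy: "x \<in> S" "y \<in> S" "R x y"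
    have "insert x (M x) \<in> D y"
      using M(1)[of x] xy trans[of _ x y] by (auto simp: D_def)
    then have "card (insert x (M x)) \<le> c y" unfolding c_def using fin by (intro Max_ge) auto
    then show "c x < c y" using card_insert[OF xy(1)] by simp
  qed
qed

lemma clique_number_ge:
  assumes "finite (verts H)" "K \<subseteq> verts H" "clique K (edges H)"
  shows "card K \<le> clique_number H"
proof -
  have "{card K | K. K \<subseteq> verts H \<and> clique K (edges H)} \<subseteq> card ` Pow (verts H)" by auto
  then have "finite {card K | K. K \<subseteq> verts H \<and> clique K (edges H)}"
    using assms(1) finite_subset by blast
  then show ?thesis unfolding clique_number_def using assms by (intro Max_ge) auto
qed

text \<open>The hypotheses say that \<open>Q\<close> is independent and that \<open>before\<close> orients the edges outside \<open>Q\<close>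
  transitively. Chains of this orientation are cliques of \<open>H\<close>, so heights colour \<open>H - Q\<close> with
  \<open>clique_number H\<close> colours.\<close>
lemma chromatic_number_le_Suc_clique_number:
  assumes H: "finite (verts H)" "edges H \<subseteq> nsets (verts H) 2"
    and indep: "\<And>x y. \<lbrakk>x \<in> Q; y \<in> Q\<rbrakk> \<Longrightarrow> {x, y} \<notin> edges H"
    and total: "\<And>x y. \<lbrakk>x \<in> verts H - Q; y \<in> verts H - Q; x \<noteq> y\<rbrakk> \<Longrightarrow> before x y \<or> before y x"
    and irrefl: "\<And>x. \<not> before x x"
    and trans: "\<And>x y z. \<lbrakk>x \<in> verts H - Q; y \<in> verts H - Q; z \<in> verts H - Q;
        before x y; before y z; {x, y} \<in> edges H; {y, z} \<in> edges H\<rbrakk>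
      \<Longrightarrow> before x z \<and> {x, z} \<in> edges H"
  shows "chromatic_number H \<le> clique_number H + 1"
proof -
  have edgeD: "u \<in> verts H" "v \<in> verts H" "u \<noteq> v" if "{u, v} \<in> edges H" for u v
    using subsetD[OF H(2) that] by (auto simp: nsets_def card_insert_if split: if_splits)
  obtain c where c: "\<And>x. x \<in> verts H - Q \<Longrightarrow> c x < clique_number H"
    "\<And>x y. \<lbrakk>x \<in> verts H - Q; y \<in> verts H - Q; before x y \<and> {x, y} \<in> edges H\<rbrakk> \<Longrightarrow> c x < c y"
  proof (rule height_colouring[of "verts H - Q" "\<lambda>x y. before x y \<and> {x, y} \<in> edges H"
        "clique_number H"])
    fix K assume K: "K \<subseteq> verts H - Q"
      "\<forall>x\<in>K. \<forall>y\<in>K. x \<noteq> y \<longrightarrow> before x y \<and> {x, y} \<in> edges H \<or> before y x \<and> {y, x} \<in> edges H"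
    then have "clique K (edges H)" by (auto simp: clique_def insert_commute)
    then show "card K \<le> clique_number H" using K(1) H(1) by (intro clique_number_ge) auto
  qed (use H(1) irrefl trans in \<open>blast+\<close>)
  define c' where "c' x = (if x \<in> Q then clique_number H else c x)" for x
  have "proper_colouring H (clique_number H + 1) c'"
    unfolding proper_colouring_def
  proof (intro conjI allI impI)
    show "c' \<in> verts H \<rightarrow> {..<clique_number H + 1}"
      using c(1) by (auto simp: c'_def less_SucI)
  next
    fix u v assume uv: "{u, v} \<in> edges H"
    note e = edgeD[OF uv]
    consider "u \<in> Q" "v \<notin> Q" | "u \<notin> Q" "v \<in> Q" | "u \<notin> Q" "v \<notin> Q" using indep uv by blast
    then show "c' u \<noteq> c' v"
    proof cases
      case 1 then show ?thesis using c(1)[of v] e by (auto simp: c'_def)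
    next
      case 2 then show ?thesis using c(1)[of u] e by (auto simp: c'_def)
    next
      case 3
      then show ?thesis using total[of u v] c(2)[of u v] c(2)[of v u] e uv
        by (auto simp: c'_def insert_commute)
    qed
  qed
  then show ?thesis unfolding chromatic_number_def by (intro Least_le) blast
qed

section \<open>Cutting the circle of vertices\<close>

text \<open>Here \<open>F\<close> plays the role of \<open>G\<^sub>n\<close> and \<open>H\<close> that of \<open>G\<^sub>r\<close>. By \<open>4 * r \<le> n\<close> a pair of points
  within distance \<open>r\<close> of the cut at \<open>2 * r\<close> has outer gaps of size at least \<open>r\<close>. No edge of \<open>H\<close> has larger
  gaps, so the adjacency of such points depends only on their distance.\<close>
lemma chromatic_number_stretched_graph:
  assumes H: "edges H \<subseteq> nsets {1..r} 2" "edges H \<noteq> {}"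
    and F: "verts F \<subseteq> {1..n}" "edges F \<subseteq> nsets (verts F) 2" "4 * r \<le> n"
    and adj: "\<And>a b. a < b \<Longrightarrow> {a, b} \<in> edges F \<longleftrightarrow>
      (\<exists>i j. {i, j} \<in> edges H \<and> 1 \<le> i \<and> i < j \<and> j \<le> r \<and> stretches r i j n a b)"
  shows "chromatic_number F \<le> clique_number F + 1"
proof -
  define L where "L d \<longleftrightarrow> (\<exists>i. 1 \<le> i \<and> 1 \<le> d \<and> i + d \<le> r \<and> {i, i + d} \<in> edges H)" for d
  define \<delta> where "\<delta> = (LEAST d. L d)"
  obtain e where "e \<in> edges H" using H(2) by blast
  then obtain a b where "{a, b} \<in> edges H" "1 \<le> a" "a < b" "b \<le> r"
    using edge_endpoints H(1) by metis
  then have "L (b - a)" by (auto simp: L_def)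
  then have "L \<delta>" unfolding \<delta>_def by (rule LeastI)
  then obtain i0 where i0: "1 \<le> i0" "1 \<le> \<delta>" "i0 + \<delta> \<le> r" "{i0, i0 + \<delta>} \<in> edges H"
    by (auto simp: L_def)
  have \<delta>_le: "\<delta> + i \<le> j" if "{i, j} \<in> edges H" "1 \<le> i" "i < j" "j \<le> r" for i j
  proof -
    have "L (j - i)" using that by (auto simp: L_def)
    then have "\<delta> \<le> j - i" unfolding \<delta>_def by (rule Least_le)
    then show ?thesis using that(3) by simp
  qed
  have adjI: "{x, y} \<in> edges F"
    if "{i, j} \<in> edges H" "1 \<le> i" "i < j" "j \<le> r" "stretches r i j n x y" for x y i j
  proof -
    have "x < y" using that by (simp add: stretches_def)
    then show ?thesis using adj that by blast
  qed
  have adjE: "\<exists>i j. {i, j} \<in> edges H \<and> 1 \<le> i \<and> i < j \<and> j \<le> r \<and> stretches r i j n x y"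
    if "{x, y} \<in> edges F" "x < y" for x y
    using adj that by blast
  \<comment> \<open>The circle is cut at the block \<open>Q\<close>; \<open>before\<close> lists first the vertices from \<open>2 * r\<close> on and
    then those below \<open>2 * r\<close>.\<close>
  define Q where "Q = {2 * r..<2 * r + \<delta>}"
  define before where
    "before x y \<longleftrightarrow> (x < y \<and> (x < 2 * r \<longleftrightarrow> y < 2 * r)) \<or> (2 * r \<le> x \<and> y < 2 * r)" for x y
  have far: "\<delta> \<le> y - x" if "{x, y} \<in> edges F" "x < y" for x y
    using adjE[OF that] \<delta>_le by (fastforce simp: stretches_def)
  \<comment> \<open>A pair on different sides of the cut needs only the outer gaps of some edge of \<open>H\<close>: if its
    distance is at least \<open>r\<close>, then the middle gap is no restriction, and otherwise both points are
    near the cut, where the distance \<open>\<delta>\<close> suffices.\<close>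
  have across: "{z, x} \<in> edges F"
    if z: "z < 2 * r" and x: "2 * r + \<delta> \<le> x"
      and ij: "{i, j} \<in> edges H" "1 \<le> i" "i < j" "j \<le> r" "i \<le> z" "r + x \<le> n + j" for x z i j
  proof (cases "z + r \<le> x")
    case True
    then show ?thesis using ij by (intro adjI[OF ij(1-4)]) (auto simp: stretches_def)
  next
    case False
    then show ?thesis using z x i0 F(3) by (intro adjI[OF i0(4)]) (auto simp: stretches_def)
  qed
  show ?thesis
  proof (rule chromatic_number_le_Suc_clique_number[where Q = Q and before = before])
    show "finite (verts F)" using F(1) finite_subset by blast
    show "edges F \<subseteq> nsets (verts F) 2" by fact
    show "{x, y} \<notin> edges F" if "x \<in> Q" "y \<in> Q" for x y
    proof
      assume xy: "{x, y} \<in> edges F"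
      then have "x \<noteq> y" using F(2) by (auto simp: nsets_def)
      then show False
        using far[of x y] far[of y x] xy that by (cases "x < y") (auto simp: Q_def insert_commute)
    qed
    show "before x y \<or> before y x" if "x \<noteq> y" for x y
      using that by (auto simp: before_def)
    show "\<not> before x x" for x by (auto simp: before_def)
    fix x y z
    assume S: "x \<in> verts F - Q" "y \<in> verts F - Q" "z \<in> verts F - Q"
      and b: "before x y" "before y z" and e: "{x, y} \<in> edges F" "{y, z} \<in> edges F"
    have nQ: "w < 2 * r \<or> 2 * r + \<delta> \<le> w" if "w \<in> verts F - Q" for w
      using that by (auto simp: Q_def)
    have "before x z" using b by (auto simp: before_def)
    moreover have "{x, z} \<in> edges F"
    proof -
      consider (right) "2 * r \<le> x" "x < y" "y < z" | (left) "x < y" "y < z" "z < 2 * r"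
        | (turn_late) "2 * r \<le> x" "x < y" "z < 2 * r" | (turn_early) "2 * r \<le> x" "y < z" "z < 2 * r"
        using b by (auto simp: before_def)
      \<comment> \<open>An outer gap of size \<open>r\<close> dominates that of any edge of \<open>H\<close>. If \<open>x\<close> and \<open>z\<close> are on the same
        side of the cut, then the gap towards the cut is that large, and the two other gaps are
        inherited from the pair that has the vertex nearest to its end of \<open>{1..n}\<close>. If they are on
        different sides, then both outer gaps are inherited from the pair that crosses from \<open>n\<close>
        to \<open>1\<close>.\<close>
      then show ?thesis
      proof cases
        case right
        obtain i j where "{i, j} \<in> edges H" "1 \<le> i" "i < j" "j \<le> r" "stretches r i j n y z"
          using adjE[OF e(2)] right by blast
        then show ?thesis using right by (intro adjI[of i j]) (auto simp: stretches_def)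
      next
        case left
        obtain i j where "{i, j} \<in> edges H" "1 \<le> i" "i < j" "j \<le> r" "stretches r i j n x y"
          using adjE[OF e(1)] left by blast
        then show ?thesis using left F(3) by (intro adjI[of i j]) (auto simp: stretches_def)
      next
        case turn_late
        obtain i j where "{i, j} \<in> edges H" "1 \<le> i" "i < j" "j \<le> r" "stretches r i j n z y"
          using adjE[of z y] e(2) turn_late by (auto simp: insert_commute)
        then have "{z, x} \<in> edges F"
          using turn_late nQ[OF S(1)] by (intro across[of z x i j]) (auto simp: stretches_def)
        then show ?thesis by (simp add: insert_commute)
      next
        case turn_early
        obtain i j where "{i, j} \<in> edges H" "1 \<le> i" "i < j" "j \<le> r" "stretches r i j n y x"
          using adjE[of y x] e(1) turn_early by (auto simp: insert_commute)
        then have "{z, x} \<in> edges F"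
          using turn_early nQ[OF S(1)] by (intro across[of z x i j]) (auto simp: stretches_def)
        then show ?thesis by (simp add: insert_commute)
      qed
    qed
    ultimately show "before x z \<and> {x, z} \<in> edges F" ..
  qed
qed

theorem theorem6p3:
  fixes G :: "nat \<Rightarrow> ngraph" and r :: nat
  assumes "Inc_invariant_chain G"
    and "stability_index G = r"
    and "verts (G r) = {1..r}"
    and "\<exists>i\<in>{1..r}. {1, i} \<in> edges (G r)"
    and "\<exists>j\<in>{1..r}. {j, r} \<in> edges (G r)"
  shows "\<forall>n \<ge> r * (4 * r - 3). chromatic_number (G n) \<le> clique_number (G n) + 1"
proof (intro allI impI)
  fix n assume n: "r * (4 * r - 3) \<le> n"
  note G = assms(1)
  have r1: "1 \<le> r" using stability_index_stable(1)[OF G] assms(2) by simp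
  note E = Inc_invariant_chainD(3)[OF G r1]
  obtain i where i: "{1, i} \<in> edges (G r)" using assms(4) by blast
  obtain a b where "1 \<le> a" "a < b" "b \<le> r" by (rule edge_endpoints[OF i E])
  then have "2 \<le> r" by simp
  then have "r * 4 \<le> r * (4 * r - 3)" by (intro mult_le_mono2) linarith
  then have n4: "4 * r \<le> n" using n by linarith
  have image: "graph_image (Inc_upto r n) (G r) = G n"
    using stability_index_stable(2)[OF G, of n] assms(2) n4 by simp
  show "chromatic_number (G n) \<le> clique_number (G n) + 1"
  proof (rule chromatic_number_stretched_graph[OF E])
    show "edges (G r) \<noteq> {}" using i by blast
    show "verts (G n) \<subseteq> {1..n}" "edges (G n) \<subseteq> nsets (verts (G n)) 2"
      using Inc_invariant_chainD[OF G, of n] n4 r1 by auto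
    show "{a, b} \<in> edges (G n) \<longleftrightarrow> (\<exists>i j. {i, j} \<in> edges (G r) \<and> 1 \<le> i \<and> i < j \<and> j \<le> r \<and>
        stretches r i j n a b)" if "a < b" for a b
      using edge_graph_image_iff[OF E that, of n] unfolding image .
  qed (rule n4)
qed

end
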